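(* Let $a,b$ and $M$ be integers satisfying $1\le a<b<\frac{M}{2}$ and $\gcd(b,M)=1$. For an integer $L\geq 0$, define $d(m,n)$ (depending on $L$) by $$(-zq^a,-zq^{M-a};q^M)_{L}\left(1+zq^{LM+a}\right) - (-zq^b,-zq^{M-b};q^M)_{L} =: \sum_{m,n\geq 0} d(m,n)z^mq^n.$$ Then for all integers $L,m,n\geq 0$ we have $d(m,nM)\geq 0$. If in addition $M$ is even and $a$ is odd, then also $d\left(m,nM+\frac{M}{2}\right)\geq 0$ for all integers $L,m,n\geq 0$.
   Context: Notation: $(x;q)_n := \prod_{j=0}^{n-1}(1-xq^j)$ and $(x_1,\dots,x_r;q)_n := (x_1;q)_n\cdots(x_r;q)_n$, with empty products equal to $1$; thus $(-zq^s,-zq^t;q^M)_L=\prod_{j=0}^{L-1}(1+zq^{Mj+s})(1+zq^{Mj+t})$. *)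

theory Defs
  imports Complex_Main "HOL-Computational_Algebra.Polynomial"
begin

definition qpoch :: "'a::comm_ring_1 \<Rightarrow> 'a \<Rightarrow> nat \<Rightarrow> 'a" where
  "qpoch x q n = (\<Prod>j<n. 1 - x * q ^ j)"

text \<open>Polynomials in z and q with integer coefficients are elements of \<open>int poly poly\<close>: the
  outer variable is z, the inner one is q.\<close>

definition zvar :: "int poly poly" where
  "zvar = [:0, 1:]"

definition qvar :: "int poly poly" where
  "qvar = [:[:0, 1:]:]"

definition qdiff :: "nat \<Rightarrow> nat \<Rightarrow> nat \<Rightarrow> nat \<Rightarrow> int poly poly" where
  "qdiff a b M L =
     qpoch (- (zvar * qvar ^ a)) (qvar ^ M) L * qpoch (- (zvar * qvar ^ (M - a))) (qvar ^ M) L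
       * (1 + zvar * qvar ^ (L * M + a))
     - qpoch (- (zvar * qvar ^ b)) (qvar ^ M) L * qpoch (- (zvar * qvar ^ (M - b))) (qvar ^ M) L"

text \<open>The coefficient of \<open>z\<^sup>m q\<^sup>n\<close> in \<open>qdiff a b M L\<close>.\<close>

definition dcoeff :: "nat \<Rightarrow> nat \<Rightarrow> nat \<Rightarrow> nat \<Rightarrow> nat \<Rightarrow> nat \<Rightarrow> int" where
  "dcoeff a b M L m n = coeff (coeff (qdiff a b M L) m) n"

end

theory Submission
  imports Defs "HOL-Computational_Algebra.Formal_Power_Series"
begin

text \<open>Put \<open>P = q\<^sup>M\<close>. By the \<open>q\<close>-binomial theorem the coefficient of \<open>z\<^sup>m\<close> in the first product is the
  sum over \<open>r + s = m\<close> of \<open>q\<close> to the power \<open>a r + (M - a) s + M (r choose 2) + M (s choose 2)\<close>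
  times \<open>[L + 1, r] [L, s]\<close>, where \<open>[n, r]\<close> is the Gaussian binomial coefficient in \<open>P\<close>; the second
  product has \<open>b\<close> and \<open>[L, r] [L, s]\<close> instead.
  Take the terms for \<open>(r, s)\<close> and \<open>(s, r)\<close> together, with \<open>D = r - s > 0\<close>. If the terms with \<open>b\<close>
  contribute to the given power of \<open>q\<close>, then coprimality (and parity, for the shift by \<open>M / 2\<close>) makes
  \<open>x = (b - a) D / M\<close> and \<open>y = (M - a - b) D / M\<close> integers, and up to a power of \<open>q\<close> the pair equals
  \<open>[L + 1, r] [L, s] + P\<^sup>x\<^sup>+\<^sup>y [L + 1, s] [L, r] - (P\<^sup>x + P\<^sup>y) [L, r] [L, s]\<close>. Since \<open>[L + 1, s] - [L, s]\<close> has
  nonnegative coefficients, it suffices that \<open>[L + 1, r] + P\<^sup>x\<^sup>+\<^sup>y [L, r] - (P\<^sup>x + P\<^sup>y) [L, r]\<close> has.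
  Now \<open>[L, r]\<close> is the complete homogeneous symmetric function of degree \<open>L - r\<close> in \<open>1, P, \<dots>, P\<^sup>r\<close>,
  and \<open>x \<noteq> y\<close> are both at most \<open>r\<close>, so up to \<open>P\<^sup>x\<^sup>+\<^sup>y ([L, r] - [L - 1, r])\<close> this is the complete
  homogeneous symmetric function of degree \<open>L - r + 1\<close> in the powers \<open>P\<^sup>i\<close> with \<open>i\<close> different from
  \<open>x\<close> and \<open>y\<close>.\<close>

section \<open>Polynomials with nonnegative coefficients\<close>

definition nonneg_poly :: "int poly \<Rightarrow> bool" where
  "nonneg_poly p \<longleftrightarrow> (\<forall>i. 0 \<le> coeff p i)"

lemma nonneg_poly_0: "nonneg_poly 0"
  by (simp add: nonneg_poly_def)

lemma nonneg_poly_monom: "nonneg_poly (monom 1 k)"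
  by (simp add: nonneg_poly_def)

lemma nonneg_poly_1: "nonneg_poly 1"
  by (simp add: nonneg_poly_def coeff_1)

lemma nonneg_poly_add: "nonneg_poly p \<Longrightarrow> nonneg_poly q \<Longrightarrow> nonneg_poly (p + q)"
  by (simp add: nonneg_poly_def)

lemma nonneg_poly_mult: "nonneg_poly p \<Longrightarrow> nonneg_poly q \<Longrightarrow> nonneg_poly (p * q)"
  by (auto simp: nonneg_poly_def coeff_mult intro!: sum_nonneg)

lemma nonneg_poly_sum: "(\<And>i. i \<in> A \<Longrightarrow> nonneg_poly (f i)) \<Longrightarrow> nonneg_poly (sum f A)"
  by (auto simp: nonneg_poly_def coeff_sum intro!: sum_nonneg)

lemma nonneg_poly_power: "nonneg_poly p \<Longrightarrow> nonneg_poly (p ^ n)"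
  by (induction n) (auto intro: nonneg_poly_1 nonneg_poly_mult)


section \<open>Complete homogeneous symmetric functions of powers\<close>

text \<open>The coefficient of degree \<open>k\<close> is the complete homogeneous symmetric
  function of degree \<open>k\<close> in the \<open>P ^ i\<close>, \<open>i \<in> S\<close>; each
  factor is a geometric series.\<close>

definition homog_gf :: "'a::comm_ring_1 \<Rightarrow> nat set \<Rightarrow> 'a fps" where
  "homog_gf P S = (\<Prod>i\<in>S. Abs_fps (\<lambda>k. (P ^ i) ^ k))"

lemma geometric_fps_inverse:
  "(1 - fps_const c * fps_X) * Abs_fps (\<lambda>k. c ^ k) = (1 :: 'a::comm_ring_1 fps)"
proof (rule fps_ext)
  fix n
  show "fps_nth ((1 - fps_const c * fps_X) * Abs_fps (\<lambda>k. c ^ k)) n = fps_nth 1 n"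
    by (cases n) (simp_all add: left_diff_distrib mult.assoc)
qed

lemma homog_gf_remove:
  assumes "finite S" "x \<in> S"
  shows "(1 - fps_const (P ^ x) * fps_X) * homog_gf P S = homog_gf P (S - {x})"
proof -
  have "homog_gf P S = Abs_fps (\<lambda>k. (P ^ x) ^ k) * homog_gf P (S - {x})"
    unfolding homog_gf_def by (rule prod.remove[OF assms])
  then show ?thesis
    using geometric_fps_inverse[of "P ^ x"] by (simp flip: mult.assoc)
qed

lemma nonneg_homog_gf:
  assumes "nonneg_poly P"
  shows "nonneg_poly (fps_nth (homog_gf P S) k)"
proof (cases "finite S")
  case True
  then show ?thesis
  proof (induction S arbitrary: k)
    case empty
    then show ?case by (simp add: homog_gf_def nonneg_poly_0 nonneg_poly_1)
  next
    case (insert i S)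
    then have "homog_gf P (insert i S) = Abs_fps (\<lambda>k. (P ^ i) ^ k) * homog_gf P S"
      by (simp add: homog_gf_def)
    then show ?case
      using insert assms
      by (auto simp: fps_mult_nth intro!: nonneg_poly_sum nonneg_poly_mult nonneg_poly_power)
  qed
next
  case False
  then show ?thesis by (simp add: homog_gf_def nonneg_poly_0 nonneg_poly_1)
qed

lemma fps_nth_one_minus_mult_Suc:
  "fps_nth ((1 - fps_const c * fps_X) * F) (Suc k) = fps_nth F (Suc k) - c * fps_nth F k"
  for F :: "'a::comm_ring_1 fps"
  by (simp add: left_diff_distrib mult.assoc)

lemma fps_nth_one_minus_mult_0:
  "fps_nth ((1 - fps_const c * fps_X) * F) 0 = fps_nth F 0"
  for F :: "'a::comm_ring_1 fps"
  by (simp add: left_diff_distrib mult.assoc)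


section \<open>Gaussian binomial coefficients\<close>

text \<open>Without the case distinction, truncated subtraction would give 1 for
  \<open>n < r\<close>.\<close>

definition gauss_binomial :: "'a::comm_ring_1 \<Rightarrow> nat \<Rightarrow> nat \<Rightarrow> 'a" where
  "gauss_binomial P n r = (if r \<le> n then fps_nth (homog_gf P {..r}) (n - r) else 0)"

lemma gauss_binomial_0: "gauss_binomial P n 0 = 1"
  by (simp add: gauss_binomial_def homog_gf_def)

lemma gauss_binomial_eq_0: "n < r \<Longrightarrow> gauss_binomial P n r = 0"
  by (simp add: gauss_binomial_def)

lemma gauss_binomial_Suc_Suc:
  "gauss_binomial P (Suc n) (Suc r) =
     gauss_binomial P n r + P ^ Suc r * gauss_binomial P n (Suc r)"
proof -
  have rem: "(1 - fps_const (P ^ Suc r) * fps_X) * homog_gf P {..Suc r} = homog_gf P {..r}"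
    using homog_gf_remove[of "{..Suc r}" "Suc r" P] by (simp add: atMost_Suc)
  consider "n < r" | "n = r" | k where "n = Suc (r + k)"
    by (metis less_imp_Suc_add linorder_neqE_nat)
  then show ?thesis
  proof cases
    case 2
    then show ?thesis
      using fps_nth_one_minus_mult_0[of "P ^ Suc r" "homog_gf P {..Suc r}"]
      unfolding rem by (simp add: gauss_binomial_def)
  next
    case 3
    then show ?thesis
      using fps_nth_one_minus_mult_Suc[of "P ^ Suc r" "homog_gf P {..Suc r}" k]
      unfolding rem by (simp add: gauss_binomial_def Suc_diff_le)
  qed (simp add: gauss_binomial_def)
qed

text \<open>The Pascal recursion builds Gaussian binomials from 0, 1 and \<open>P\<close> by sums
  and products alone.\<close>

lemma gauss_binomial_closed:
  assumes "C 0" "C 1" "C P" "\<And>p q. C p \<Longrightarrow> C q \<Longrightarrow> C (p + q)" "\<And>p q. C p \<Longrightarrow> C q \<Longrightarrow> C (p * q)"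
  shows "C (gauss_binomial P n r)"
proof (induction n arbitrary: r)
  case 0
  show ?case
    using assms by (cases r) (simp_all add: gauss_binomial_0 gauss_binomial_eq_0)
next
  case (Suc n)
  have "C (P ^ k)" for k
    by (induction k) (use assms in auto)
  then show ?case
    using assms Suc.IH by (cases r) (simp_all only: gauss_binomial_0 gauss_binomial_Suc_Suc)
qed

lemma nonneg_gauss_binomial: "nonneg_poly P \<Longrightarrow> nonneg_poly (gauss_binomial P n r)"
  by (simp add: gauss_binomial_def nonneg_homog_gf nonneg_poly_0)

lemma dvd_of_coeff_gauss_binomial:
  assumes "coeff (gauss_binomial (monom 1 M) n r :: int poly) i \<noteq> 0"
  shows "M dvd i"
proof -
  define C :: "int poly \<Rightarrow> bool" where "C p \<longleftrightarrow> (\<forall>i. coeff p i \<noteq> 0 \<longrightarrow> M dvd i)" for p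
  have "C (gauss_binomial (monom 1 M) n r)"
  proof (rule gauss_binomial_closed)
    fix p q :: "int poly"
    assume C: "C p" "C q"
    show "C (p + q)"
      using C unfolding C_def by (metis add.right_neutral coeff_add)
    show "C (p * q)"
      unfolding C_def
    proof (intro allI impI)
      fix i
      assume "coeff (p * q) i \<noteq> 0"
      then obtain j where "j \<le> i" "coeff p j * coeff q (i - j) \<noteq> 0"
        by (metis (no_types, lifting) atMost_iff coeff_mult sum.neutral)
      then have "j \<le> i" "M dvd j" "M dvd (i - j)"
        using C by (auto simp: C_def)
      then show "M dvd i"
        by (metis dvd_add le_add_diff_inverse)
    qed
  qed (auto simp: C_def coeff_1 split: if_splits)
  with assms show ?thesis by (auto simp: C_def)
qed

text \<open>Removing the variable \<open>P ^ 0 = 1\<close> turns the difference into a complete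
  homogeneous symmetric function in the remaining powers.\<close>

lemma gauss_binomial_mono:
  assumes "nonneg_poly P"
  shows "nonneg_poly (gauss_binomial P (Suc n) r - gauss_binomial P n r)"
proof (cases "r \<le> n")
  case True
  have "fps_nth (homog_gf P ({..r} - {0})) (Suc (n - r)) =
      fps_nth (homog_gf P {..r}) (Suc (n - r)) - fps_nth (homog_gf P {..r}) (n - r)"
    using homog_gf_remove[of "{..r}" 0 P]
      fps_nth_one_minus_mult_Suc[of "P ^ 0" "homog_gf P {..r}" "n - r"] by simp
  then show ?thesis
    using nonneg_homog_gf[OF assms, of "{..r} - {0}" "Suc (n - r)"] True
    by (simp add: gauss_binomial_def Suc_diff_le)
next
  case False
  then show ?thesis
    using nonneg_gauss_binomial[OF assms] by (simp add: gauss_binomial_eq_0)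
qed

text \<open>Multisets of size \<open>n - r + 1\<close> on \<open>{0..r}\<close> that contain neither \<open>x\<close> nor \<open>y\<close> are counted
  by inclusion-exclusion; this is where \<open>x \<noteq> y\<close> enters.\<close>

lemma gauss_binomial_two_removed:
  assumes P: "nonneg_poly P" and xy: "x \<le> r" "y \<le> r" "x \<noteq> y"
  shows "nonneg_poly (gauss_binomial P (Suc n) r + P ^ (x + y) * gauss_binomial P n r
    - (P ^ x + P ^ y) * gauss_binomial P n r)"
proof (cases "r \<le> n")
  case True
  then obtain N where n: "n = r + N"
    using le_Suc_ex by blast
  define H where "H = homog_gf P {..r}"
  define Hx where "Hx = homog_gf P ({..r} - {x})"
  define Hxy where "Hxy = homog_gf P ({..r} - {x} - {y})"
  have Hx: "(1 - fps_const (P ^ x) * fps_X) * H = Hx"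
    unfolding H_def Hx_def using xy by (intro homog_gf_remove) auto
  have Hxy: "(1 - fps_const (P ^ y) * fps_X) * Hx = Hxy"
    unfolding Hxy_def Hx_def using xy by (intro homog_gf_remove) auto
  note nth_Suc = fps_nth_one_minus_mult_Suc[of "P ^ x" H, unfolded Hx]
    fps_nth_one_minus_mult_Suc[of "P ^ y" Hx, unfolded Hxy]
  note nth_0 = fps_nth_one_minus_mult_0[of "P ^ x" H, unfolded Hx]
  have nonneg: "nonneg_poly (fps_nth Hxy k)" for k
    unfolding Hxy_def by (rule nonneg_homog_gf[OF P])
  have Ppow: "nonneg_poly (P ^ k)" for k
    using P by (rule nonneg_poly_power)
  have binom: "gauss_binomial P (Suc n) r = fps_nth H (Suc N)" "gauss_binomial P n r = fps_nth H N"
    by (simp_all add: gauss_binomial_def H_def n Suc_diff_le)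
  show ?thesis
  \<comment> \<open>Removing both variables brings in the coefficient of \<open>H\<close> at
    \<open>N - 1\<close>, which is absent for \<open>N = 0\<close>.\<close>
  proof (cases N)
    case 0
    have "gauss_binomial P (Suc n) r + P ^ (x + y) * gauss_binomial P n r
        - (P ^ x + P ^ y) * gauss_binomial P n r = fps_nth Hxy 1 + P ^ (x + y) * fps_nth H 0"
      unfolding binom 0 using nth_Suc[of 0] nth_0 by (simp add: algebra_simps)
    then show ?thesis
      using nonneg[of 1] nonneg_homog_gf[OF P, of "{..r}" 0] Ppow
      by (simp add: H_def nonneg_poly_add nonneg_poly_mult)
  next
    case (Suc k)
    have "gauss_binomial P (Suc n) r + P ^ (x + y) * gauss_binomial P n r
        - (P ^ x + P ^ y) * gauss_binomial P n r =
        fps_nth Hxy (Suc N) + P ^ (x + y) * (fps_nth H (Suc k) - fps_nth H k)"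
      unfolding binom Suc by (simp add: nth_Suc algebra_simps power_add)
    moreover have "nonneg_poly (fps_nth H (Suc k) - fps_nth H k)"
      using gauss_binomial_mono[OF P, of "r + k" r]
      by (simp add: gauss_binomial_def H_def Suc_diff_le)
    ultimately show ?thesis
      using nonneg[of "Suc N"] Ppow by (simp add: nonneg_poly_add nonneg_poly_mult)
  qed
next
  case False
  then show ?thesis
    using nonneg_gauss_binomial[OF P] by (simp add: gauss_binomial_eq_0)
qed

text \<open>The finite \<open>q\<close>-binomial theorem. Splitting off the factor
  \<open>j = 0\<close> replaces \<open>c\<close> by \<open>c * P\<close>, so the induction must
  generalize over \<open>c\<close>.\<close>

lemma coeff_prod_linear:
  fixes c P :: "'a::comm_ring_1"
  shows "coeff (\<Prod>j<n. [:1, c * P ^ j:]) r = c ^ r * P ^ (r choose 2) * gauss_binomial P n r"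
proof (induction n arbitrary: c r)
  case 0
  show ?case
    by (cases r) (simp_all add: gauss_binomial_0 gauss_binomial_eq_0 binomial_eq_0)
next
  case (Suc n)
  have "(\<Prod>j<Suc n. [:1, c * P ^ j:]) = [:1, c:] * (\<Prod>j<n. [:1, (c * P) * P ^ j:])"
    by (simp only: prod.lessThan_Suc_shift) (simp add: mult_ac)
  then have split: "coeff (\<Prod>j<Suc n. [:1, c * P ^ j:]) r =
      coeff ([:1, c:] * (\<Prod>j<n. [:1, (c * P) * P ^ j:])) r"
    by simp
  show ?case
  proof (cases r)
    case 0
    then show ?thesis
      unfolding split by (simp add: Suc.IH gauss_binomial_0 binomial_eq_0)
  next
    case (Suc k)
    have lin: "coeff ([:1, c:] * p) (Suc k) = coeff p (Suc k) + c * coeff p k" for p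
      by simp
    have choose: "Suc k choose 2 = k + (k choose 2)"
      by (simp add: numeral_2_eq_2)
    show ?thesis
      unfolding split unfolding Suc lin Suc.IH gauss_binomial_Suc_Suc choose
      by (simp add: power_add power_mult_distrib algebra_simps)
  qed
qed


section \<open>Pairing the terms with exponents (r, s) and (s, r)\<close>

definition theta_term :: "nat \<Rightarrow> nat \<Rightarrow> nat \<Rightarrow> nat \<Rightarrow> nat \<Rightarrow> nat \<Rightarrow> int poly" where
  "theta_term M K L a r s =
     monom 1 (a * r + (M - a) * s + M * ((r choose 2) + (s choose 2)))
       * (gauss_binomial (monom 1 M) K r * gauss_binomial (monom 1 M) L s)"

lemma qpoch_conv_prod_linear:
  "qpoch (- (zvar * qvar ^ a)) (qvar ^ M) n = (\<Prod>j<n. [:1, monom 1 a * monom 1 M ^ j:])"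
proof -
  have q: "qvar ^ k = [:monom 1 k:]" for k
    by (induction k) (simp_all add: qvar_def monom_Suc monom_0 one_pCons)
  show ?thesis
    unfolding qpoch_def
    by (intro prod.cong refl) (simp add: zvar_def q one_pCons poly_const_pow)
qed

lemma coeff_qpoch_pair:
  assumes "a \<le> M"
  shows "coeff (qpoch (- (zvar * qvar ^ a)) (qvar ^ M) K
      * qpoch (- (zvar * qvar ^ (M - a))) (qvar ^ M) L) m
    = (\<Sum>r\<le>m. theta_term M K L a r (m - r))"
  unfolding qpoch_conv_prod_linear coeff_mult coeff_prod_linear
  by (intro sum.cong refl) (simp add: theta_term_def monom_power mult_monom algebra_simps)


lemma theta_term_pair_nonneg:
  assumes ab: "a < b" "2 * b < M"
    and dvd: "M dvd (b - a) * D" "M dvd (M - a - b) * D" and D: "0 < D"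
  shows "nonneg_poly (theta_term M (Suc L) L a (s + D) s + theta_term M (Suc L) L a s (s + D)
    - (theta_term M L L b (s + D) s + theta_term M L L b s (s + D)))"
proof -
  define r where "r = s + D"
  define P :: "int poly" where "P = monom 1 M"
  define g where "g = gauss_binomial P"
  define u where "u = b - a"
  define v where "v = M - a - b"
  obtain x y where x: "u * D = M * x" and y: "v * D = M * y"
    using dvd unfolding u_def v_def by (auto elim!: dvdE)
  have b: "b = a + u" and M: "M = 2 * a + u + v" and uv: "u < v"
    using ab by (auto simp: u_def v_def)
  have "0 < M"
    using ab by simp
  have "M * x \<le> M * D" "M * y \<le> M * D"
    unfolding x[symmetric] y[symmetric] using M by (auto intro!: mult_le_mono1)
  then have xy: "x \<le> r" "y \<le> r"
    using \<open>0 < M\<close> by (auto simp: r_def)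
  \<comment> \<open>Here \<open>2 * b < M\<close> enters, in the form \<open>u < v\<close>.\<close>
  have "x \<noteq> y"
    using x y uv D by (metis mult_cancel2 nat_neq_iff)
  \<comment> \<open>The least of the four exponents, factored out of the whole pair.\<close>
  define E where "E = a * D + M * s + M * ((r choose 2) + (s choose 2))"
  have shift: "monom 1 (E + M * k) = monom 1 E * P ^ k" for k
    by (simp add: P_def monom_power mult_monom)
  have Ma: "M - a = a + u + v" and Mb: "M - b = a + v"
    using M b by auto
  have exps:
    "a * r + (M - a) * s + M * ((r choose 2) + (s choose 2)) = E"
    "a * s + (M - a) * r + M * ((s choose 2) + (r choose 2)) = E + M * (x + y)"
    "b * r + (M - b) * s + M * ((r choose 2) + (s choose 2)) = E + M * x"
    "b * s + (M - b) * r + M * ((s choose 2) + (r choose 2)) = E + M * y"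
  proof -
    let ?C = "M * ((r choose 2) + (s choose 2))"
    have C: "M * ((s choose 2) + (r choose 2)) = ?C"
      by (simp add: add.commute)
    have Ms: "M * s = 2 * a * s + u * s + v * s"
      by (simp add: M algebra_simps)
    show "a * r + (M - a) * s + ?C = E"
      unfolding Ma E_def Ms by (simp add: r_def algebra_simps)
    show "a * s + (M - a) * r + M * ((s choose 2) + (r choose 2)) = E + M * (x + y)"
      unfolding C Ma E_def Ms distrib_left[of M x y] x[symmetric] y[symmetric]
      by (simp add: r_def algebra_simps)
    show "b * r + (M - b) * s + ?C = E + M * x"
      unfolding Mb unfolding b E_def Ms x[symmetric] by (simp add: r_def algebra_simps)
    show "b * s + (M - b) * r + M * ((s choose 2) + (r choose 2)) = E + M * y"
      unfolding C Mb unfolding b E_def Ms y[symmetric] by (simp add: r_def algebra_simps)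
  qed
  have "theta_term M (Suc L) L a r s + theta_term M (Suc L) L a s r
      - (theta_term M L L b r s + theta_term M L L b s r) =
      monom 1 E * ((g (Suc L) r + P ^ (x + y) * g L r - (P ^ x + P ^ y) * g L r) * g L s
        + P ^ (x + y) * (g (Suc L) s - g L s) * g L r)"
    unfolding theta_term_def exps shift P_def[symmetric] g_def by (simp add: algebra_simps)
  moreover have "nonneg_poly P"
    by (simp add: P_def nonneg_poly_monom)
  ultimately show ?thesis
    using xy \<open>x \<noteq> y\<close> unfolding r_def[symmetric] g_def
    by (auto intro!: nonneg_poly_mult nonneg_poly_add nonneg_poly_monom nonneg_poly_power
        gauss_binomial_two_removed gauss_binomial_mono nonneg_gauss_binomial)
qed

lemma theta_term_nonneg: "nonneg_poly (theta_term M K L a r s)"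
  by (simp add: theta_term_def nonneg_poly_mult nonneg_poly_monom nonneg_gauss_binomial)

text \<open>For \<open>r = s\<close> the exponent depends on neither \<open>a\<close> nor
  \<open>b\<close>, so only monotonicity in \<open>L\<close> is needed.\<close>

lemma theta_term_diagonal_nonneg:
  assumes "a \<le> M" "b \<le> M"
  shows "nonneg_poly (theta_term M (Suc L) L a r r - theta_term M L L b r r)"
proof -
  have "c * r + (M - c) * r = M * r" if "c \<le> M" for c
    using that by (simp flip: distrib_right)
  then have "theta_term M (Suc L) L a r r - theta_term M L L b r r =
      monom 1 (M * r + M * ((r choose 2) + (r choose 2)))
        * ((gauss_binomial (monom 1 M) (Suc L) r - gauss_binomial (monom 1 M) L r)
          * gauss_binomial (monom 1 M) L r)"
    using assms by (simp add: theta_term_def algebra_simps)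
  then show ?thesis
    by (simp add: nonneg_poly_mult nonneg_poly_monom nonneg_gauss_binomial gauss_binomial_mono)
qed

lemma coeff_theta_term_nonzero:
  assumes "coeff (theta_term M K L b r s) N \<noteq> 0"
  obtains k where "N = b * r + (M - b) * s + M * k"
proof -
  let ?g = "gauss_binomial (monom 1 M) K r * gauss_binomial (monom 1 M) L s :: int poly"
  define e where "e = b * r + (M - b) * s + M * ((r choose 2) + (s choose 2))"
  have "e \<le> N" "coeff ?g (N - e) \<noteq> 0"
    using assms by (auto simp: theta_term_def e_def coeff_monom_mult split: if_splits)
  then obtain j where j: "j \<le> N - e"
      "coeff (gauss_binomial (monom 1 M) K r :: int poly) j
        * coeff (gauss_binomial (monom 1 M) L s) (N - e - j) \<noteq> 0"
    by (metis (no_types, lifting) atMost_iff coeff_mult sum.neutral)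
  then have "M dvd j" "M dvd N - e - j"
    by (auto intro: dvd_of_coeff_gauss_binomial)
  then have "M dvd N - e"
    using j(1) by (metis dvd_add le_add_diff_inverse)
  then obtain k where "N = e + M * k"
    using \<open>e \<le> N\<close> by (metis dvdE le_add_diff_inverse)
  then have "N = b * r + (M - b) * s + M * ((r choose 2) + (s choose 2) + k)"
    by (simp add: e_def algebra_simps)
  then show thesis
    by (rule that)
qed

text \<open>If the divisibilities fail for some \<open>D\<close>, neither term with \<open>b\<close>
  at distance \<open>D\<close> reaches \<open>N\<close>, and the terms with \<open>a\<close> are
  nonnegative anyway.\<close>

lemma dcoeff_nonneg_if:
  assumes ab: "a < b" "2 * b < M"
    and dvd: "\<And>D k. N = b * D + M * k \<or> N = (M - b) * D + M * k \<Longrightarrow>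
      M dvd (b - a) * D \<and> M dvd (M - a - b) * D"
  shows "0 \<le> dcoeff a b M L m N"
proof -
  define U where "U r s = theta_term M (Suc L) L a r s - theta_term M L L b r s" for r s
  have off_diagonal: "0 \<le> coeff (U (s + D) s) N + coeff (U s (s + D)) N" if "0 < D" for s D
  proof (cases "M dvd (b - a) * D \<and> M dvd (M - a - b) * D")
    case True
    then show ?thesis
      using theta_term_pair_nonneg[OF ab _ _ that, of L s]
      by (simp add: nonneg_poly_def U_def algebra_simps)
  next
    case False
    have Ms: "b * s + (M - b) * s = M * s"
      using ab by (simp flip: distrib_right)
    have "coeff (theta_term M L L b (s + D) s) N = 0"
    proof (rule ccontr)
      assume "\<not> ?thesis"
      then obtain k where "N = b * (s + D) + (M - b) * s + M * k"
        by (rule coeff_theta_term_nonzero)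
      then have "N = b * D + M * (s + k)"
        using Ms by (simp add: distrib_left)
      with dvd False show False by blast
    qed
    moreover have "coeff (theta_term M L L b s (s + D)) N = 0"
    proof (rule ccontr)
      assume "\<not> ?thesis"
      then obtain k where "N = b * s + (M - b) * (s + D) + M * k"
        by (rule coeff_theta_term_nonzero)
      then have "N = (M - b) * D + M * (s + k)"
        using Ms by (simp add: distrib_left)
      with dvd False show False by blast
    qed
    ultimately show ?thesis
      using theta_term_nonneg by (simp add: U_def nonneg_poly_def)
  qed
  have pair: "0 \<le> coeff (U r s) N + coeff (U s r) N" for r s
  proof (cases r s rule: linorder_cases)
    case equal
    then show ?thesis
      using theta_term_diagonal_nonneg[of a M b L r] ab by (simp add: U_def nonneg_poly_def)
  next
    case less
    then show ?thesis
      using off_diagonal[of "s - r" r] by simp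
  next
    case greater
    then show ?thesis
      using off_diagonal[of "r - s" s] by simp
  qed
  \<comment> \<open>The extra factor is the one with index \<open>j = L\<close> of the first
    product.\<close>
  have "1 + zvar * qvar ^ (L * M + a) = 1 - - (zvar * qvar ^ a) * (qvar ^ M) ^ L"
    by (simp add: power_add mult_ac flip: power_mult)
  then have "qpoch (- (zvar * qvar ^ a)) (qvar ^ M) L * (1 + zvar * qvar ^ (L * M + a)) =
      qpoch (- (zvar * qvar ^ a)) (qvar ^ M) (Suc L)"
    by (simp add: qpoch_def)
  then have "qdiff a b M L =
      qpoch (- (zvar * qvar ^ a)) (qvar ^ M) (Suc L)
        * qpoch (- (zvar * qvar ^ (M - a))) (qvar ^ M) L
      - qpoch (- (zvar * qvar ^ b)) (qvar ^ M) L * qpoch (- (zvar * qvar ^ (M - b))) (qvar ^ M) L"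
    unfolding qdiff_def by (simp add: mult_ac)
  then have dc: "dcoeff a b M L m N = (\<Sum>r\<le>m. coeff (U r (m - r)) N)"
    using ab by (simp add: dcoeff_def coeff_qpoch_pair U_def coeff_sum sum_subtractf)
  \<comment> \<open>Adding the reflected sum pairs every term, the diagonal one with itself.\<close>
  also have "\<dots> = (\<Sum>r\<le>m. coeff (U (m - r) r) N)"
    by (rule sum.reindex_bij_witness[of _ "\<lambda>r. m - r" "\<lambda>r. m - r"]) auto
  finally have "2 * dcoeff a b M L m N =
      (\<Sum>r\<le>m. coeff (U r (m - r)) N + coeff (U (m - r) r) N)"
    using dc by (simp add: sum.distrib)
  also have "\<dots> \<ge> 0"
    by (intro sum_nonneg pair)
  finally show ?thesis by simp
qed

theorem theorem1p3:
  fixes a b M :: nat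
  assumes "1 \<le> a" and "a < b" and "real b < real M / 2" and "gcd b M = 1"
  shows "(\<forall>L m n :: nat. 0 \<le> dcoeff a b M L m (n * M))
    \<and> (even M \<and> odd a \<longrightarrow> (\<forall>L m n :: nat. 0 \<le> dcoeff a b M L m (n * M + M div 2)))"
proof -
  have ab: "a < b" "2 * b < M"
    using assms by auto
  have cop: "coprime M b" "coprime M (M - b)"
    using assms(4) gcd_diff2_nat[of b M] ab
    by (simp_all add: coprime_iff_gcd_eq_1 gcd.commute)
  show ?thesis
  proof (intro conjI impI allI)
    fix L m n
    show "0 \<le> dcoeff a b M L m (n * M)"
    proof (rule dcoeff_nonneg_if[OF ab])
      fix D k
      assume "n * M = b * D + M * k \<or> n * M = (M - b) * D + M * k"
      then have "M dvd b * D \<or> M dvd (M - b) * D"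
        by (metis dvd_add_left_iff dvd_triv_left dvd_triv_right)
      then have "M dvd D"
        using cop by (auto simp: coprime_dvd_mult_right_iff)
      then show "M dvd (b - a) * D \<and> M dvd (M - a - b) * D"
        by simp
    qed
  next
    assume parity: "even M \<and> odd a"
    then obtain h where h: "M = 2 * h"
      by blast
    have "odd b"
      using cop(1) parity by (meson coprime_common_divisor_nat odd_one dvd_refl coprime_def)
    fix L m n
    show "0 \<le> dcoeff a b M L m (n * M + M div 2)"
    proof (rule dcoeff_nonneg_if[OF ab])
      fix D k
      assume "n * M + M div 2 = b * D + M * k \<or> n * M + M div 2 = (M - b) * D + M * k"
      then have "h * (2 * n + 1) = b * D + h * (2 * k) \<or> h * (2 * n + 1) = (M - b) * D + h * (2 * k)"
        by (simp add: h algebra_simps)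
      then have "h dvd b * D \<or> h dvd (M - b) * D"
        by (metis dvd_add_left_iff dvd_triv_left)
      moreover have "coprime h b" "coprime h (M - b)"
        using cop unfolding h by (simp_all add: coprime_mult_left_iff)
      ultimately have "h dvd D"
        by (auto simp: coprime_dvd_mult_right_iff)
      \<comment> \<open>Only \<open>h = M / 2\<close> is known to divide \<open>D\<close>; the
        missing factor 2 comes from \<open>a\<close> and \<open>b\<close> being odd.\<close>
      moreover have "even (b - a)" "even (M - a - b)"
        using \<open>odd b\<close> parity ab by auto
      ultimately show "M dvd (b - a) * D \<and> M dvd (M - a - b) * D"
        unfolding h by (auto intro: mult_dvd_mono)
    qed
  qed
qed

end
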